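(* Let $(X,d)$ be a complete $b$-metric space with coefficient $K\ge 1$. Let $T\colon X\to X$ be a mapping for which there exist real numbers $\alpha,\beta$ with $0\le\alpha<1$, $\beta\ge 0$ and $0\le\alpha+\beta<1$ such that $$d(Tx,Ty)\le \alpha\, d(x,y)+\beta\, d(x,Tx)\quad\text{for all } x,y\in X.$$ If $(\alpha+\beta)K<1$, then $T$ has a unique fixed point.
   Context: A $b$-metric space with coefficient $K\ge 1$ is a nonempty set $X$ with a function $d\colon X\times X\to[0,\infty)$ such that for all $x,y,z\in X$: $d(x,y)=0$ if and only if $x=y$; $d(x,y)=d(y,x)$; and $d(x,y)\le K[d(x,z)+d(z,y)]$. A sequence $(x_n)$ in $X$ converges to $x\in X$ if $d(x_n,x)\to 0$; it is Cauchy if $d(x_n,x_m)\to 0$ as $n,m\to\infty$; $(X,d)$ is complete if every Cauchy sequence converges to some point of $X$. *)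

theory Defs
  imports Complex_Main "HOL-Library.FuncSet"
begin

text \<open>The axioms constrain \<open>d\<close> only on the carrier \<open>X\<close>; its values elsewhere are arbitrary.\<close>

locale b_metric_space =
  fixes X :: "'a set" and d :: "'a \<Rightarrow> 'a \<Rightarrow> real" and K :: real
  assumes coefficient_ge_1: "K \<ge> 1"
    and nonempty: "X \<noteq> {}"
    and nonneg: "\<lbrakk>x \<in> X; y \<in> X\<rbrakk> \<Longrightarrow> 0 \<le> d x y"
    and zero_iff: "\<lbrakk>x \<in> X; y \<in> X\<rbrakk> \<Longrightarrow> d x y = 0 \<longleftrightarrow> x = y"
    and commute: "\<lbrakk>x \<in> X; y \<in> X\<rbrakk> \<Longrightarrow> d x y = d y x"
    and relaxed_triangle: "\<lbrakk>x \<in> X; y \<in> X; z \<in> X\<rbrakk> \<Longrightarrow> d x y \<le> K * (d x z + d z y)"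

definition b_converges_to :: "'a set \<Rightarrow> ('a \<Rightarrow> 'a \<Rightarrow> real) \<Rightarrow> (nat \<Rightarrow> 'a) \<Rightarrow> 'a \<Rightarrow> bool" where
  "b_converges_to X d s x \<longleftrightarrow> range s \<subseteq> X \<and> x \<in> X \<and> (\<lambda>n. d (s n) x) \<longlonglongrightarrow> 0"

text \<open>The product filter expresses the joint limit \<open>n, m \<rightarrow> \<infinity>\<close>.\<close>

definition b_Cauchy :: "'a set \<Rightarrow> ('a \<Rightarrow> 'a \<Rightarrow> real) \<Rightarrow> (nat \<Rightarrow> 'a) \<Rightarrow> bool" where
  "b_Cauchy X d s \<longleftrightarrow> range s \<subseteq> X \<and>
     ((\<lambda>(n, m). d (s n) (s m)) \<longlongrightarrow> 0) (sequentially \<times>\<^sub>F sequentially)"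

definition b_complete :: "'a set \<Rightarrow> ('a \<Rightarrow> 'a \<Rightarrow> real) \<Rightarrow> bool" where
  "b_complete X d \<longleftrightarrow> (\<forall>s. b_Cauchy X d s \<longrightarrow> (\<exists>x. b_converges_to X d s x))"

end

theory Submission
  imports Defs
begin

text \<open>
  Put \<open>r = \<alpha> + \<beta>\<close>. Applied to the pair \<open>x\<close>, \<open>T x\<close>, the contraction condition says that
  \<open>d (T x) (T (T x)) \<le> r * d x (T x)\<close>, so the steps of every Picard orbit shrink geometrically with
  ratio \<open>r\<close>. Splitting off the steps of a chain one at a time by the relaxed triangle inequality
  costs one further factor \<open>K\<close> per step. The distance between two points of the orbit is thus
  dominated by a geometric series in \<open>r * K\<close>, and \<open>r * K < 1\<close> makes the orbit Cauchy
  (\<open>b_Cauchy_if_geometric_steps\<close>).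

  A \<open>b\<close>-metric need not be continuous, so the equation for the limit \<open>u\<close> of the orbit \<open>s\<close> cannot be
  obtained by passing to the limit inside \<open>d\<close>. Instead, \<open>d u (T u)\<close> is bounded through the point
  \<open>T (s n)\<close>. The contraction condition is asymmetric, and with \<open>s n\<close> in the first place it bounds
  \<open>d (T (s n)) (T u)\<close> by \<open>\<alpha> * d (s n) u + \<beta> * d (s n) (T (s n))\<close>, which vanishes in the limit.
  For two fixed points the \<open>\<beta>\<close> term is zero, and \<open>\<alpha> < 1\<close> gives uniqueness.
\<close>

text \<open>
  The constant \<open>C = K / (1 - r * K)\<close> is the solution of \<open>C = K * (1 + C * r)\<close>. This is exactly the
  equation needed for an induction that splits off the first step of the chain, since the remaining
  chain starts at index \<open>n + 1\<close> and its bound carries the additional factor \<open>r\<close>.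
\<close>

lemma (in b_metric_space) dist_le_if_geometric_steps:
  assumes s: "\<And>n. s n \<in> X" and r: "0 \<le> r" "r * K < 1"
    and step: "\<And>n. d (s n) (s (Suc n)) \<le> c * r ^ n"
  shows "d (s n) (s (n + p)) \<le> K / (1 - r * K) * c * r ^ n"
proof (induction p arbitrary: n)
  case 0
  have "0 \<le> c"
    using nonneg[OF s s, of 0 "Suc 0"] step[of 0] by simp
  moreover have "0 \<le> K / (1 - r * K)"
    using r coefficient_ge_1 by simp
  ultimately have "0 \<le> K / (1 - r * K) * c * r ^ n"
    using r(1) by (intro mult_nonneg_nonneg zero_le_power)
  then show ?case
    using zero_iff[OF s s, of n n] by simp
next
  case (Suc p)
  define C where "C = K / (1 - r * K)"
  have C: "C = K * (1 + C * r)"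
    using r by (simp add: C_def field_simps)
  have IH: "d (s (Suc n)) (s (n + Suc p)) \<le> C * c * r ^ Suc n"
    using Suc.IH[of "Suc n"] by (simp add: C_def)
  have "d (s n) (s (n + Suc p)) \<le> K * (d (s n) (s (Suc n)) + d (s (Suc n)) (s (n + Suc p)))"
    by (rule relaxed_triangle[OF s s s])
  also have "\<dots> \<le> K * (c * r ^ n + C * c * r ^ Suc n)"
    using step[of n] IH coefficient_ge_1 by (intro mult_left_mono add_mono) auto
  also have "\<dots> = K * (1 + C * r) * c * r ^ n"
    by (simp add: algebra_simps)
  also have "\<dots> = C * c * r ^ n"
    using C by simp
  finally show ?case
    by (simp add: C_def)
qed

lemma (in b_metric_space) b_Cauchy_if_geometric_steps:
  assumes s: "\<And>n. s n \<in> X" and r: "0 \<le> r" "r * K < 1"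
    and step: "\<And>n. d (s n) (s (Suc n)) \<le> c * r ^ n"
  shows "b_Cauchy X d s"
proof -
  define D where "D = K / (1 - r * K) * c"
  have tail: "d (s n) (s m) \<le> D * r ^ n" if "n \<le> m" for n m
    using dist_le_if_geometric_steps[OF s r step, of n "m - n"] that by (simp add: D_def)
  have D: "0 \<le> D"
    using nonneg[OF s s, of 0 0] tail[of 0 0] by simp
  \<comment> \<open>The sum of both tails serves as a bound independent of the order of the two indices.\<close>
  have bound: "d (s n) (s m) \<le> D * r ^ n + D * r ^ m" for n m
  proof (cases "n \<le> m")
    case True
    then show ?thesis
      using tail[of n m] D r by (smt (verit) mult_nonneg_nonneg zero_le_power)
  next
    case False
    then show ?thesis
      using tail[of m n] commute[OF s s, of n m] D r
      by (smt (verit) mult_nonneg_nonneg zero_le_power nle_le)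
  qed
  have "r < 1"
    using r coefficient_ge_1 mult_left_mono[of 1 K r] by simp
  then have lim: "(\<lambda>n. D * r ^ n) \<longlonglongrightarrow> 0"
    using r by (intro tendsto_mult_right_zero LIMSEQ_power_zero) simp
  have "((\<lambda>p. D * r ^ fst p + D * r ^ snd p) \<longlongrightarrow> 0 + 0) (sequentially \<times>\<^sub>F sequentially)"
    by (intro tendsto_add filterlim_compose[OF lim])
      (simp_all add: filterlim_def filtermap_fst_prod_filter filtermap_snd_prod_filter)
  then have "((\<lambda>p. D * r ^ fst p + D * r ^ snd p) \<longlongrightarrow> 0) (sequentially \<times>\<^sub>F sequentially)"
    by simp
  from _ _ tendsto_const this have "((\<lambda>(n, m). d (s n) (s m)) \<longlongrightarrow> 0) (sequentially \<times>\<^sub>F sequentially)"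
    by (rule tendsto_sandwich) (auto intro!: always_eventually simp: nonneg s bound)
  then show ?thesis
    using s by (auto simp: b_Cauchy_def)
qed

theorem corollary2p2:
  fixes X :: "'a set" and d :: "'a \<Rightarrow> 'a \<Rightarrow> real" and T :: "'a \<Rightarrow> 'a"
    and K \<alpha> \<beta> :: real
  assumes "b_metric_space X d K"
    and "b_complete X d"
    and "T \<in> X \<rightarrow> X"
    and "0 \<le> \<alpha>" and "\<alpha> < 1" and "\<beta> \<ge> 0" and "0 \<le> \<alpha> + \<beta>" and "\<alpha> + \<beta> < 1"
    and "\<And>x y. \<lbrakk>x \<in> X; y \<in> X\<rbrakk> \<Longrightarrow> d (T x) (T y) \<le> \<alpha> * d x y + \<beta> * d x (T x)"
    and "(\<alpha> + \<beta>) * K < 1"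
  shows "\<exists>!x. x \<in> X \<and> T x = x"
proof -
  interpret b_metric_space X d K
    by fact
  note contraction = assms(9)
  have T: "T x \<in> X" if "x \<in> X" for x
    using assms(3) that by auto
  obtain x0 where x0: "x0 \<in> X"
    using nonempty by auto
  define s where "s n = (T ^^ n) x0" for n
  have s_Suc: "s (Suc n) = T (s n)" for n
    by (simp add: s_def)
  have s: "s n \<in> X" for n
    by (induction n) (auto simp: s_def x0 T)
  have step: "d (s n) (s (Suc n)) \<le> d (s 0) (s 1) * (\<alpha> + \<beta>) ^ n" for n
  proof (induction n)
    case (Suc n)
    have "d (s (Suc n)) (s (Suc (Suc n))) \<le> (\<alpha> + \<beta>) * d (s n) (s (Suc n))"
      using contraction[OF s s, of n "Suc n"] by (simp add: s_Suc algebra_simps)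
    also have "\<dots> \<le> (\<alpha> + \<beta>) * (d (s 0) (s 1) * (\<alpha> + \<beta>) ^ n)"
      using Suc assms(7) by (rule mult_left_mono)
    finally show ?case
      by (simp add: algebra_simps)
  qed simp
  have "b_Cauchy X d s"
    using s assms(7,10) step by (rule b_Cauchy_if_geometric_steps)
  then obtain u where u: "u \<in> X" and su: "(\<lambda>n. d (s n) u) \<longlonglongrightarrow> 0"
    using assms(2) by (auto simp: b_complete_def b_converges_to_def)
  have steps: "(\<lambda>n. d (s n) (s (Suc n))) \<longlonglongrightarrow> 0"
  proof (rule tendsto_sandwich[OF _ _ tendsto_const])
    show "(\<lambda>n. d (s 0) (s 1) * (\<alpha> + \<beta>) ^ n) \<longlonglongrightarrow> 0"
      using assms(7,8) by (intro tendsto_mult_right_zero LIMSEQ_power_zero) simp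
  qed (auto intro!: always_eventually simp: nonneg s step[simplified])
  have bound: "d u (T u) \<le> K * (d (s (Suc n)) u + (\<alpha> * d (s n) u + \<beta> * d (s n) (s (Suc n))))" for n
  proof -
    have "d u (T u) \<le> K * (d u (s (Suc n)) + d (s (Suc n)) (T u))"
      by (rule relaxed_triangle[OF u T[OF u] s])
    also have "\<dots> \<le> K * (d (s (Suc n)) u + (\<alpha> * d (s n) u + \<beta> * d (s n) (s (Suc n))))"
      using contraction[OF s u, of n] coefficient_ge_1
      by (intro mult_left_mono add_mono) (simp_all add: s_Suc[symmetric] commute[OF u s])
    finally show ?thesis .
  qed
  have "(\<lambda>n. K * (d (s (Suc n)) u + (\<alpha> * d (s n) u + \<beta> * d (s n) (s (Suc n))))) \<longlonglongrightarrow> 0"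
    by (intro tendsto_mult_right_zero tendsto_add_zero LIMSEQ_Suc[OF su] su steps)
  then have "d u (T u) \<le> 0"
    using bound by (intro LIMSEQ_le_const) auto
  then have Tu: "T u = u"
    using nonneg[OF u T[OF u]] zero_iff[OF u T[OF u]] by simp
  show ?thesis
  proof (rule ex1I[of _ u])
    show "u \<in> X \<and> T u = u"
      using u Tu by simp
  next
    fix v assume v: "v \<in> X \<and> T v = v"
    then have "d u v \<le> \<alpha> * d u v"
      using contraction[of u v] u Tu zero_iff[OF u u] by simp
    then have "(1 - \<alpha>) * d u v \<le> 0"
      by (simp add: algebra_simps)
    then have "d u v \<le> 0"
      using assms(5) by (simp add: mult_le_0_iff)
    then show "v = u"
      using nonneg[of u v] zero_iff[of u v] u v by simp
  qed
qed

end
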